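(* Let $X_1,\ldots,X_l$ be independent random variables and let $E_1,\ldots,E_m$ be events, each $E_j$ depending only on the variables in its scope $\mathrm{sc}(E_j)$. For $i,j\in\{1,\ldots,m\}$, if $E_i$ is $d$-dependent on $E_j$, then $E_i$ and $E_j$ are MT-dependent.
   Context: Variable framework: the probability space is the product space of independent random variables $X_1,\ldots,X_l$; each event $E_j$ is determined by the values of a subset $\mathrm{sc}(E_j)$ of these variables, called its scope. Assignments are assignments of values to $X_1,\ldots,X_l$. $\overline{E}$ denotes the complement of $E$. $d$-dependency: $E_i$ is $d$-dependent on $E_j$ if there exists an assignment $\alpha$ under which $E_j$ occurs and $E_i$ does not, and such that the values of the variables in $\mathrm{sc}(E_j)$ can be changed (all other values of $\alpha$ being kept) so that $E_i$ occurs and $E_j$ ceases occurring. MT-dependency (lopsidependency of Moser and Tardos): $E_i,E_j$ are MT-dependent if there exist two assignments $\alpha,\beta$ that differ only on variables in $\mathrm{sc}(E_i)\cap\mathrm{sc}(E_j)$, such that (1) $\alpha$ makes $E_i$ occur and $\beta$ makes $E_j$ occur, and (2) either $\overline{E}_i$ occurs under $\beta$ or $\overline{E}_j$ occurs under $\alpha$. *)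

theory Defs
  imports "HOL-Probability.Probability"
begin

text \<open>
  The product space of the variables \<open>X k\<close>, \<open>k \<in> I\<close>. Its points are the assignments: functions
  giving each variable a value in its value space \<open>space (N k)\<close>. Events are measurable sets of
  assignments; an event \<open>A\<close> occurs under the assignment \<open>\<alpha>\<close> iff \<open>\<alpha> \<in> A\<close>.
\<close>

definition var_space ::
  "'w measure \<Rightarrow> (nat \<Rightarrow> 'a measure) \<Rightarrow> (nat \<Rightarrow> 'w \<Rightarrow> 'a) \<Rightarrow> nat set \<Rightarrow> (nat \<Rightarrow> 'a) measure" where
  "var_space P N X I = PiM I (\<lambda>k. distr P (N k) (X k))"

definition differ_only_on :: "nat set \<Rightarrow> nat set \<Rightarrow> (nat \<Rightarrow> 'a) \<Rightarrow> (nat \<Rightarrow> 'a) \<Rightarrow> bool" where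
  "differ_only_on I S \<alpha> \<beta> \<longleftrightarrow> (\<forall>k \<in> I - S. \<alpha> k = \<beta> k)"

text \<open>
  A scope is any set of variables that determines the event; it need not be the least one.
\<close>

definition is_scope :: "(nat \<Rightarrow> 'a) measure \<Rightarrow> nat set \<Rightarrow> nat set \<Rightarrow> (nat \<Rightarrow> 'a) set \<Rightarrow> bool" where
  "is_scope \<Omega> I S A \<longleftrightarrow>
     S \<subseteq> I \<and>
     (\<forall>\<alpha> \<in> space \<Omega>. \<forall>\<beta> \<in> space \<Omega>. (\<forall>k \<in> S. \<alpha> k = \<beta> k) \<longrightarrow> (\<alpha> \<in> A \<longleftrightarrow> \<beta> \<in> A))"

text \<open>
  \<open>d_dependent \<Omega> I sc E i j\<close>: the event \<open>E i\<close> is d-dependent on the event \<open>E j\<close>. This relation is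
  not symmetric in \<open>i\<close> and \<open>j\<close>.
\<close>

definition d_dependent ::
  "(nat \<Rightarrow> 'a) measure \<Rightarrow> nat set \<Rightarrow> (nat \<Rightarrow> nat set) \<Rightarrow> (nat \<Rightarrow> (nat \<Rightarrow> 'a) set) \<Rightarrow> nat \<Rightarrow> nat \<Rightarrow> bool"
  where
  "d_dependent \<Omega> I sc E i j \<longleftrightarrow>
     (\<exists>\<alpha> \<in> space \<Omega>. \<alpha> \<in> E j \<and> \<alpha> \<notin> E i \<and>
       (\<exists>\<beta> \<in> space \<Omega>. differ_only_on I (sc j) \<alpha> \<beta> \<and> \<beta> \<in> E i \<and> \<beta> \<notin> E j))"

definition MT_dependent ::
  "(nat \<Rightarrow> 'a) measure \<Rightarrow> nat set \<Rightarrow> (nat \<Rightarrow> nat set) \<Rightarrow> (nat \<Rightarrow> (nat \<Rightarrow> 'a) set) \<Rightarrow> nat \<Rightarrow> nat \<Rightarrow> bool"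
  where
  "MT_dependent \<Omega> I sc E i j \<longleftrightarrow>
     (\<exists>\<alpha> \<in> space \<Omega>. \<exists>\<beta> \<in> space \<Omega>.
        differ_only_on I (sc i \<inter> sc j) \<alpha> \<beta> \<and>
        (\<alpha> \<in> E i \<and> \<beta> \<in> E j) \<and>
        (\<beta> \<in> space \<Omega> - E i \<or> \<alpha> \<in> space \<Omega> - E j))"

end

theory Submission
  imports Defs
begin

text \<open>
  If \<open>\<alpha>\<close> and \<open>\<beta>\<close> witness the d-dependency of \<open>E i\<close> on \<open>E j\<close>, overwrite \<open>\<alpha>\<close> with the values of \<open>\<beta>\<close> on
  \<open>sc i \<inter> sc j\<close> only. The result agrees with \<open>\<beta>\<close> on all of \<open>sc i\<close>, so \<open>E i\<close> still occurs under it, and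
  together with \<open>\<alpha>\<close> it witnesses the MT-dependency.
\<close>

text \<open>Membership is tested coordinate by coordinate, including the value
  \<open>undefined\<close> off \<open>I\<close>.\<close>

lemma override_on_space_PiM:
  assumes "\<alpha> \<in> space (PiM I M)" "\<beta> \<in> space (PiM I M)"
  shows "override_on \<alpha> \<beta> S \<in> space (PiM I M)"
  using assms by (auto simp: space_PiM PiE_def Pi_def extensional_def override_on_def)

lemma d_dependent_imp_MT_dependent:
  assumes scope: "is_scope (PiM I M) I (sc i) (E i)"
    and dep: "d_dependent (PiM I M) I sc E i j"
  shows "MT_dependent (PiM I M) I sc E i j"
proof -
  from dep obtain \<alpha> \<beta> where \<alpha>: "\<alpha> \<in> space (PiM I M)" "\<alpha> \<in> E j" "\<alpha> \<notin> E i"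
    and \<beta>: "\<beta> \<in> space (PiM I M)" "\<beta> \<in> E i" and diff: "differ_only_on I (sc j) \<alpha> \<beta>"
    unfolding d_dependent_def by blast
  define \<gamma> where "\<gamma> = override_on \<alpha> \<beta> (sc i \<inter> sc j)"
  have \<gamma>: "\<gamma> \<in> space (PiM I M)"
    unfolding \<gamma>_def using \<alpha>(1) \<beta>(1) by (rule override_on_space_PiM)
  \<comment> \<open>On \<open>sc i - sc j\<close>, \<gamma> keeps the value of \<alpha>, which is
    that of \<beta> by \<open>diff\<close>; this uses \<open>sc i \<subseteq> I\<close> from
    \<open>scope\<close>.\<close>
  have "\<forall>k \<in> sc i. \<gamma> k = \<beta> k"
    using scope diff unfolding is_scope_def differ_only_on_def \<gamma>_def override_on_def by auto
  with scope \<beta> \<gamma> have "\<gamma> \<in> E i"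
    unfolding is_scope_def by blast
  moreover have "differ_only_on I (sc i \<inter> sc j) \<gamma> \<alpha>"
    by (auto simp: differ_only_on_def \<gamma>_def override_on_def)
  \<comment> \<open>The witnesses are \<gamma> for \<open>E i\<close> and \<alpha> for
    \<open>E j\<close>, in this order; the first disjunct holds since
    \<open>\<alpha> \<notin> E i\<close>.\<close>
  ultimately show ?thesis
    unfolding MT_dependent_def using \<alpha> \<gamma> by blast
qed

theorem claim1:
  fixes P :: "'w measure" and N :: "nat \<Rightarrow> 'a measure" and X :: "nat \<Rightarrow> 'w \<Rightarrow> 'a"
    and l m :: nat and sc :: "nat \<Rightarrow> nat set" and E :: "nat \<Rightarrow> (nat \<Rightarrow> 'a) set"
    and i j :: nat
  assumes "prob_space P"
    and "prob_space.indep_vars P N X {1..l}"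
    and "\<forall>r \<in> {1..m}. E r \<in> sets (var_space P N X {1..l})"
    and "\<forall>r \<in> {1..m}. is_scope (var_space P N X {1..l}) {1..l} (sc r) (E r)"
    and "i \<in> {1..m}" and "j \<in> {1..m}"
    and "d_dependent (var_space P N X {1..l}) {1..l} sc E i j"
  shows "MT_dependent (var_space P N X {1..l}) {1..l} sc E i j"
  using assms(4,5,7) unfolding var_space_def by (blast intro: d_dependent_imp_MT_dependent)

end
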